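(* Let $n\ge1$ be an integer. For every integer $d\ge1$ and every subset $Z\subset Q^n_1$, if $\dim_eZ>n-1$ then $\omega_d(Z)>0$. In particular, $\omega_d(Z)>0$ if $\dim_HZ>n-1$.
   Context: $Q^n_1=[0,1]^n\subset\mathbb{R}^n$ is the unit cube and $\mu_n$ is Lebesgue measure. For a bounded set $A\subset\mathbb{R}^n$ and $\varepsilon>0$, $M(\varepsilon,A)$ is the minimal number of closed axis-parallel cubes of edge length $\varepsilon$ covering $A$. For a real polynomial $P$ on $\mathbb{R}^n$ and $\rho\ge 0$ put $V_\rho(P)=\{x\in Q^n_1: |P(x)|\le\rho\}$. Vitushkin's bound (a known result) states that there are positive constants $C_i(n,d)$, $0\le i\le n-1$, depending only on $n,d$, such that for every real polynomial $P$ in $n$ variables of degree at most $d$, every $\rho\ge0$ and every $\varepsilon>0$, $$M(\varepsilon,V_\rho(P))\le\sum_{i=0}^{n-1}C_i(n,d)\varepsilon^{-i}+\mu_n(V_\rho(P))\varepsilon^{-n}.$$ Such constants are fixed: $C_0(1,d)=d$; $C_0(2,d)=(2d-1)^2$, $C_1(2,d)=8d$; in general they have the form $C_i(n,d)=C_i'(n)(2d)^{n-i}$. Put $M_d(\varepsilon)=\sum_{i=0}^{n-1}C_i(n,d)\varepsilon^{-i}$. The metric $d$-span of $Z\subset Q^n_1$ is $\omega_d(Z)=\sup_{\varepsilon>0}\varepsilon^n[M(\varepsilon,Z)-M_d(\varepsilon)]$. The entropy (upper box) dimension of a bounded set $A$ is $\dim_eA=\inf\{\beta:\ \exists K$ such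 that $M(\varepsilon,A)\le K\varepsilon^{-\beta}$ for each $0<\varepsilon\le1\}$. $\dim_HA$ is the Hausdorff dimension. *)

theory Defs
  imports "HOL-Analysis.Analysis"
begin

abbreviation unit_cube :: "(real ^ 'n) set" where
  "unit_cube \<equiv> cbox 0 1"

definition cubes :: "real \<Rightarrow> (real ^ 'n) set set" where
  "cubes \<epsilon> = {cbox a (a + \<epsilon> *\<^sub>R 1) | a. True}"

text \<open>For bounded \<open>A\<close> and \<open>\<epsilon> > 0\<close> a finite cover exists (lemma \<open>finite_cube_cover\<close> below),
  so the least element is attained.\<close>
definition covering_number :: "real \<Rightarrow> (real ^ 'n) set \<Rightarrow> nat" where
  "covering_number \<epsilon> A = (LEAST m. \<exists>F \<subseteq> cubes \<epsilon>. finite F \<and> card F = m \<and> A \<subseteq> \<Union>F)"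

lemma finite_cube_cover:
  fixes A :: "(real ^ 'n) set"
  assumes "bounded A" "\<epsilon> > 0"
  shows "\<exists>F \<subseteq> cubes \<epsilon>. finite F \<and> A \<subseteq> \<Union>F"
proof -
  define h :: "real ^ 'n" where "h = (\<epsilon> / 2) *\<^sub>R 1"
  define U where "U = (\<lambda>c :: real ^ 'n. box (c - h) (c + h))"
  have "compact (closure A)"
    using assms(1) by (simp add: compact_closure)
  moreover have "closure A \<subseteq> (\<Union>c\<in>UNIV. U c)"
  proof
    fix x :: "real ^ 'n"
    have "x \<in> U x"
      using assms(2) by (simp add: U_def h_def mem_box_cart)
    then show "x \<in> (\<Union>c\<in>UNIV. U c)" by blast
  qed
  ultimately obtain D where D: "finite D" "closure A \<subseteq> (\<Union>c\<in>D. U c)"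
    using compactE_image[of "closure A" UNIV U] by (auto simp: U_def open_box)
  let ?F = "(\<lambda>c. cbox (c - h) (c - h + \<epsilon> *\<^sub>R 1)) ` D"
  have "c + h = c - h + \<epsilon> *\<^sub>R 1" for c
    by (simp add: h_def vec_eq_iff)
  from this[symmetric] have "U c \<subseteq> cbox (c - h) (c - h + \<epsilon> *\<^sub>R 1)" for c
    unfolding U_def using box_subset_cbox[of "c - h" "c + h"] by (simp only:)
  then have "(\<Union>c\<in>D. U c) \<subseteq> \<Union>?F" by (rule UN_mono[OF subset_refl])
  then have "A \<subseteq> \<Union>?F"
    using D(2) closure_subset[of A] by (meson subset_trans)
  moreover have "?F \<subseteq> cubes \<epsilon>" "finite ?F"
    using D(1) by (auto simp: cubes_def)
  ultimately show ?thesis by blast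
qed

definition poly_fun_le :: "nat \<Rightarrow> (real ^ 'n \<Rightarrow> real) \<Rightarrow> bool" where
  "poly_fun_le d P \<longleftrightarrow>
    (\<exists>c :: ('n \<Rightarrow> nat) \<Rightarrow> real. \<forall>x.
      P x = (\<Sum>\<alpha> | sum \<alpha> UNIV \<le> d. c \<alpha> * (\<Prod>i\<in>UNIV. (x $ i) ^ \<alpha> i)))"

text \<open>The sum above is over a finite set, so it is not silently zero.\<close>
lemma finite_multiindices: "finite {\<alpha> :: 'n::finite \<Rightarrow> nat. sum \<alpha> UNIV \<le> d}"
proof (rule finite_subset)
  show "{\<alpha> :: 'n \<Rightarrow> nat. sum \<alpha> UNIV \<le> d} \<subseteq> (\<Pi>\<^sub>E i\<in>UNIV. {..d})"
  proof
    fix \<alpha> :: "'n \<Rightarrow> nat"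
    assume "\<alpha> \<in> {\<alpha>. sum \<alpha> UNIV \<le> d}"
    then have le: "sum \<alpha> UNIV \<le> d" by simp
    have "\<alpha> i \<le> d" for i
    proof (rule order_trans[OF _ le])
      show "\<alpha> i \<le> sum \<alpha> UNIV" by (rule member_le_sum) simp_all
    qed
    then show "\<alpha> \<in> (\<Pi>\<^sub>E i\<in>UNIV. {..d})" by auto
  qed
qed (simp add: finite_PiE)

definition sublevel :: "real \<Rightarrow> (real ^ 'n \<Rightarrow> real) \<Rightarrow> (real ^ 'n) set" where
  "sublevel \<rho> P = {x \<in> unit_cube. \<bar>P x\<bar> \<le> \<rho>}"

definition vitushkin_sum :: "(nat \<Rightarrow> nat \<Rightarrow> real) \<Rightarrow> nat \<Rightarrow> nat \<Rightarrow> real \<Rightarrow> real" where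
  "vitushkin_sum C n d \<epsilon> = (\<Sum>i<n. C i d / \<epsilon> ^ i)"

text \<open>\<open>C i d\<close> is the constant $C_i(n,d)$ for the dimension $n = $ \<open>CARD('n)\<close>.
  The general form $C_i'(n)(2d)^{n-i}$ is required only for $n \ge 3$: the value
  $C_0(2,d) = (2d-1)^2$ is not of that form, and for $n = 1$ the value $C_0(1,d) = d$
  already is. Degree bounds start at 1, since for $n = 1$, $d = 0$ the bound with
  $C_0(1,0) = 0$ fails for $P = 0$.\<close>
definition vitushkin_constants :: "'n::finite itself \<Rightarrow> (nat \<Rightarrow> nat \<Rightarrow> real) \<Rightarrow> bool" where
  "vitushkin_constants (_ :: 'n itself) C \<longleftrightarrow>
    (\<forall>d\<ge>1. \<forall>i<CARD('n). C i d > 0) \<and>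
    (\<forall>d\<ge>1. \<forall>P :: real ^ 'n \<Rightarrow> real. \<forall>\<rho>\<ge>0. \<forall>\<epsilon>>0. poly_fun_le d P \<longrightarrow>
       real (covering_number \<epsilon> (sublevel \<rho> P))
         \<le> vitushkin_sum C CARD('n) d \<epsilon> + measure lebesgue (sublevel \<rho> P) / \<epsilon> ^ CARD('n)) \<and>
    (CARD('n) = 1 \<longrightarrow> (\<forall>d\<ge>1. C 0 d = real d)) \<and>
    (CARD('n) = 2 \<longrightarrow> (\<forall>d\<ge>1. C 0 d = (2 * real d - 1)\<^sup>2 \<and> C 1 d = 8 * real d)) \<and>
    (CARD('n) \<ge> 3 \<longrightarrow>
       (\<exists>C'. \<forall>d\<ge>1. \<forall>i<CARD('n). C i d = C' i * (2 * real d) ^ (CARD('n) - i)))"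

definition metric_span :: "(nat \<Rightarrow> nat \<Rightarrow> real) \<Rightarrow> nat \<Rightarrow> (real ^ 'n) set \<Rightarrow> ereal" where
  "metric_span C d Z =
    (SUP \<epsilon>\<in>{0<..}. ereal (\<epsilon> ^ CARD('n) *
       (real (covering_number \<epsilon> Z) - vitushkin_sum C CARD('n) d \<epsilon>)))"

text \<open>Taken in the extended reals because for the empty set every real \<open>\<beta>\<close> is admissible;
  its entropy dimension is then \<open>-\<infinity>\<close>.\<close>
definition entropy_dim :: "(real ^ 'n) set \<Rightarrow> ereal" where
  "entropy_dim A = Inf {ereal \<beta> | \<beta>.
     \<exists>K. \<forall>\<epsilon>. 0 < \<epsilon> \<and> \<epsilon> \<le> 1 \<longrightarrow> real (covering_number \<epsilon> A) \<le> K * \<epsilon> powr (-\<beta>)}"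

text \<open>$\mathrm{diam}(U)^s$ with the conventions that the empty set has gauge 0 and $0^0 = 1$;
  the case split is needed because \<open>0 powr 0 = 0\<close>.\<close>
definition diam_gauge :: "real \<Rightarrow> 'a::metric_space set \<Rightarrow> ennreal" where
  "diam_gauge s U =
    (if U = {} then 0 else if s = 0 then 1 else ennreal (diameter U powr s))"

text \<open>Covers consist of bounded sets because \<open>diameter\<close> is unspecified on unbounded ones.\<close>
definition hausdorff_content :: "real \<Rightarrow> real \<Rightarrow> 'a::metric_space set \<Rightarrow> ennreal" where
  "hausdorff_content s \<delta> A =
    Inf {\<Sum>i. diam_gauge s (U i) | U :: nat \<Rightarrow> 'a set.
      A \<subseteq> (\<Union>i. U i) \<and> (\<forall>i. bounded (U i) \<and> diameter (U i) \<le> \<delta>)}"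

definition hausdorff_measure :: "real \<Rightarrow> 'a::metric_space set \<Rightarrow> ennreal" where
  "hausdorff_measure s A = (SUP \<delta>\<in>{0<..}. hausdorff_content s \<delta> A)"

definition hausdorff_dim :: "'a::metric_space set \<Rightarrow> ereal" where
  "hausdorff_dim A = Inf {ereal s | s. s \<ge> 0 \<and> hausdorff_measure s A = 0}"

end

theory Submission
  imports Defs
begin

text \<open>
  If \<open>\<omega>\<^sub>d(Z) \<le> 0\<close>, then the covering number of \<open>Z\<close> is at most \<open>M\<^sub>d(\<epsilon>)\<close> at every scale. As \<open>M\<^sub>d\<close>
  is a polynomial of degree \<open>n - 1\<close> in \<open>1/\<epsilon>\<close>, it is \<open>O(\<epsilon>\<^sup>-\<^sup>(\<^sup>n\<^sup>-\<^sup>1\<^sup>))\<close> on \<open>(0, 1]\<close>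
  (\<open>vitushkin_sum_le\<close>), so \<open>n - 1\<close> is an admissible exponent for the entropy dimension and
  \<open>dim\<^sub>e Z \<le> n - 1\<close>.

  The statement on the Hausdorff dimension reduces to the one on the entropy dimension, because
  for nonempty sets the former is at most the latter (\<open>hausdorff_dim_le_entropy_dim\<close>): a cover
  by \<open>O(\<epsilon>\<^sup>-\<^sup>\<beta>)\<close> cubes of edge \<open>\<epsilon>\<close> has total \<open>s\<close>-gauge \<open>O(\<epsilon>\<^sup>s\<^sup>-\<^sup>\<beta>)\<close>, which vanishes in the limit
  when \<open>s > \<beta>\<close>.
\<close>

lemma covering_number_attained:
  fixes A :: "(real ^ 'n) set"
  assumes "bounded A" "\<epsilon> > 0"
  obtains F where "F \<subseteq> cubes \<epsilon>" "finite F" "card F = covering_number \<epsilon> A" "A \<subseteq> \<Union>F"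
proof -
  have "\<exists>m. \<exists>F \<subseteq> cubes \<epsilon>. finite F \<and> card F = m \<and> A \<subseteq> \<Union>F"
    using finite_cube_cover[OF assms] by blast
  from LeastI_ex[OF this] show ?thesis
    using that unfolding covering_number_def by blast
qed

lemma bounded_cube: "Q \<in> cubes \<epsilon> \<Longrightarrow> bounded Q"
  by (auto simp: cubes_def)

lemma diameter_cube:
  fixes Q :: "(real ^ 'n) set"
  assumes "Q \<in> cubes \<epsilon>" "\<epsilon> > 0"
  shows "diameter Q = norm (1 :: real ^ 'n) * \<epsilon>"
proof -
  obtain a where a: "Q = cbox a (a + \<epsilon> *\<^sub>R 1)"
    using assms(1) by (auto simp: cubes_def)
  have "\<forall>i\<in>Basis. a \<bullet> i \<le> (a + \<epsilon> *\<^sub>R 1) \<bullet> i"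
    using assms(2) by (auto simp: Basis_vec_def inner_axis)
  then show ?thesis
    using assms(2) unfolding a by (simp add: diameter_cbox dist_norm)
qed

lemma hausdorff_content_le_finite_cover:
  fixes F :: "'a::metric_space set set"
  assumes "finite F" "A \<subseteq> \<Union>F" "\<And>Q. Q \<in> F \<Longrightarrow> bounded Q \<and> diameter Q \<le> \<delta>" "\<delta> \<ge> 0"
  shows "hausdorff_content s \<delta> A \<le> (\<Sum>Q\<in>F. diam_gauge s Q)"
proof -
  obtain e where e: "bij_betw e {..<card F} F"
    using ex_bij_betw_nat_finite[OF assms(1)] by (auto simp: atLeast0LessThan)
  \<comment> \<open>The content is defined through sequences of sets; the empty set pads the enumeration
    at no cost.\<close>
  define U where "U i = (if i < card F then e i else {})" for i
  have UF: "U i \<in> F" if "i < card F" for i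
    using e that by (auto simp: U_def bij_betw_def)
  have "A \<subseteq> (\<Union>i. U i)"
  proof
    fix x assume "x \<in> A"
    then obtain Q where Q: "Q \<in> F" "x \<in> Q" using assms(2) by auto
    then obtain i where "i < card F" "e i = Q"
      using bij_betw_imp_surj_on[OF e] by (metis imageE lessThan_iff)
    then show "x \<in> (\<Union>i. U i)" using Q by (auto simp: U_def)
  qed
  moreover have "bounded (U i) \<and> diameter (U i) \<le> \<delta>" for i
    using UF[of i] assms(3,4) by (cases "i < card F") (auto simp: U_def)
  ultimately have "hausdorff_content s \<delta> A \<le> (\<Sum>i. diam_gauge s (U i))"
    unfolding hausdorff_content_def by (intro Inf_lower) blast
  also have "\<dots> = (\<Sum>i<card F. diam_gauge s (U i))"
    by (rule suminf_finite) (auto simp: U_def diam_gauge_def)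
  also have "\<dots> = (\<Sum>i<card F. diam_gauge s (e i))"
    by (intro sum.cong) (auto simp: U_def)
  also have "\<dots> = (\<Sum>Q\<in>F. diam_gauge s Q)"
    using e by (rule sum.reindex_bij_betw)
  finally show ?thesis .
qed

text \<open>An optimal cover by cubes is admissible for the Hausdorff content, and every cube in it has
  diameter \<open>\<epsilon> \<surd>n\<close>.\<close>
lemma hausdorff_content_le_covering_number:
  fixes A :: "(real ^ 'n) set"
  assumes "bounded A" "\<epsilon> > 0" "s > 0" "norm (1 :: real ^ 'n) * \<epsilon> \<le> \<delta>"
  shows "hausdorff_content s \<delta> A
    \<le> ennreal (real (covering_number \<epsilon> A) * (norm (1 :: real ^ 'n) * \<epsilon>) powr s)"
proof -
  let ?c = "norm (1 :: real ^ 'n)"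
  obtain F where F: "F \<subseteq> cubes \<epsilon>" "finite F" "card F = covering_number \<epsilon> A" "A \<subseteq> \<Union>F"
    using covering_number_attained[OF assms(1,2)] .
  have "0 \<le> ?c * \<epsilon>" using assms(2) by simp
  then have "0 \<le> \<delta>" using assms(4) by linarith
  then have "hausdorff_content s \<delta> A \<le> (\<Sum>Q\<in>F. diam_gauge s Q)"
    using F assms(2,4)
    by (intro hausdorff_content_le_finite_cover) (auto simp: diameter_cube bounded_cube subset_iff)
  also have "\<dots> \<le> (\<Sum>Q\<in>F. ennreal ((?c * \<epsilon>) powr s))"
  proof (rule sum_mono)
    fix Q assume "Q \<in> F"
    then have "diameter Q = ?c * \<epsilon>" using F(1) assms(2) by (auto intro: diameter_cube)
    then show "diam_gauge s Q \<le> ennreal ((?c * \<epsilon>) powr s)"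
      using assms(3) by (simp add: diam_gauge_def)
  qed
  also have "\<dots> = ennreal (real (covering_number \<epsilon> A) * (?c * \<epsilon>) powr s)"
    by (simp add: F(3) ennreal_mult ennreal_of_nat_eq_real_of_nat)
  finally show ?thesis .
qed

text \<open>The requirement \<open>s > 0\<close> is separate from \<open>\<beta> < s\<close> because the empty set admits negative
  exponents \<open>\<beta>\<close>.\<close>
lemma hausdorff_measure_eq_0:
  fixes A :: "(real ^ 'n) set"
  assumes "bounded A" "s > 0" "\<beta> < s"
    and K: "\<And>\<epsilon>. 0 < \<epsilon> \<Longrightarrow> \<epsilon> \<le> 1 \<Longrightarrow> real (covering_number \<epsilon> A) \<le> K * \<epsilon> powr (-\<beta>)"
  shows "hausdorff_measure s A = 0"
proof -
  define c where "c = norm (1 :: real ^ 'n)"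
  have "c > 0" by (simp add: c_def)
  have "hausdorff_content s \<delta> A = 0" if "\<delta> > 0" for \<delta>
  proof -
    have small: "\<forall>\<^sub>F \<epsilon> in at_right (0::real). 0 < \<epsilon> \<and> \<epsilon> < min 1 (\<delta> / c)"
      using \<open>c > 0\<close> \<open>\<delta> > 0\<close>
      by (auto simp: eventually_at_right_field intro!: exI[of _ "min 1 (\<delta> / c)"])
    have "\<forall>\<^sub>F \<epsilon> in at_right 0. hausdorff_content s \<delta> A \<le> ennreal (K * c powr s * \<epsilon> powr (s - \<beta>))"
      using small
    proof eventually_elim
      case (elim \<epsilon>)
      then have "c * \<epsilon> \<le> \<delta>" using \<open>c > 0\<close> by (simp add: field_simps)
      then have "hausdorff_content s \<delta> A
          \<le> ennreal (real (covering_number \<epsilon> A) * (c * \<epsilon>) powr s)"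
        using hausdorff_content_le_covering_number[of A \<epsilon> s \<delta>] assms(1,2) elim
        by (simp add: c_def)
      also have "\<dots> \<le> ennreal (K * \<epsilon> powr (-\<beta>) * (c * \<epsilon>) powr s)"
        using K[of \<epsilon>] elim by (intro ennreal_leI mult_right_mono) auto
      also have "K * \<epsilon> powr (-\<beta>) * (c * \<epsilon>) powr s = K * c powr s * \<epsilon> powr (s - \<beta>)"
        using elim \<open>c > 0\<close> by (simp add: powr_mult powr_diff powr_minus field_simps)
      finally show ?case .
    qed
    moreover have "((\<lambda>\<epsilon>. ennreal (K * c powr s * \<epsilon> powr (s - \<beta>))) \<longlongrightarrow> ennreal 0) (at_right 0)"
    proof (rule tendsto_ennrealI)
      have "((\<lambda>\<epsilon>. \<epsilon> powr (s - \<beta>)) \<longlongrightarrow> 0 powr (s - \<beta>)) (at_right (0::real))"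
        using assms(3) by (intro tendsto_powr' tendsto_intros)
          (auto simp: eventually_at_right_field intro: exI[of _ 1])
      from tendsto_mult_right_zero[OF this[simplified]]
      show "((\<lambda>\<epsilon>. K * c powr s * \<epsilon> powr (s - \<beta>)) \<longlongrightarrow> 0) (at_right 0)" .
    qed
    ultimately have "hausdorff_content s \<delta> A \<le> ennreal 0"
      by (intro tendsto_lowerbound[where F = "at_right (0::real)"]) auto
    then show ?thesis by simp
  qed
  then show ?thesis by (simp add: hausdorff_measure_def)
qed

text \<open>The maximum with \<open>0\<close> accounts for the empty set, whose dimensions are \<open>0\<close> and
  \<open>-\<infinity>\<close>.\<close>
lemma hausdorff_dim_le_entropy_dim:
  fixes A :: "(real ^ 'n) set"
  assumes "bounded A"
  shows "hausdorff_dim A \<le> max 0 (entropy_dim A)"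
proof (rule dense_ge)
  fix t assume t: "max 0 (entropy_dim A) < t"
  then obtain s' where s': "max 0 (entropy_dim A) < s'" "s' < t"
    using dense by blast
  then obtain s where s: "s' = ereal s"
    by (cases s') auto
  then have "entropy_dim A < ereal s" "s > 0" using s' by auto
  then obtain \<beta> K where "ereal \<beta> < ereal s"
    and K: "\<forall>\<epsilon>. 0 < \<epsilon> \<and> \<epsilon> \<le> 1 \<longrightarrow> real (covering_number \<epsilon> A) \<le> K * \<epsilon> powr (-\<beta>)"
    unfolding entropy_dim_def Inf_less_iff by blast
  then have "\<beta> < s" by simp
  have "hausdorff_measure s A = 0"
    by (rule hausdorff_measure_eq_0[OF assms \<open>s > 0\<close> \<open>\<beta> < s\<close>]) (use K in blast)
  then have "hausdorff_dim A \<le> ereal s"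
    unfolding hausdorff_dim_def using s s' by (intro Inf_lower) auto
  then show "hausdorff_dim A \<le> t" using s s' by auto
qed

lemma vitushkin_sum_le:
  assumes "\<And>i. i < n \<Longrightarrow> C i d \<ge> 0" "0 < \<epsilon>" "\<epsilon> \<le> 1"
  shows "vitushkin_sum C n d \<epsilon> \<le> (\<Sum>i<n. C i d) * \<epsilon> powr (-(real n - 1))"
  unfolding vitushkin_sum_def sum_distrib_right
proof (rule sum_mono)
  fix i assume "i \<in> {..<n}"
  then have i: "i < n" by simp
  have "C i d / \<epsilon> ^ i = C i d * \<epsilon> powr (- real i)"
    using assms(2) by (simp add: powr_minus powr_realpow divide_inverse)
  also have "\<dots> \<le> C i d * \<epsilon> powr (-(real n - 1))"
    using assms i by (intro mult_left_mono powr_mono') auto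
  finally show "C i d / \<epsilon> ^ i \<le> C i d * \<epsilon> powr (-(real n - 1))" .
qed

lemma covering_number_le_if_metric_span_le_0:
  fixes Z :: "(real ^ 'n) set"
  assumes "metric_span C d Z \<le> 0" "\<epsilon> > 0"
  shows "real (covering_number \<epsilon> Z) \<le> vitushkin_sum C CARD('n) d \<epsilon>"
proof -
  have "ereal (\<epsilon> ^ CARD('n) * (real (covering_number \<epsilon> Z) - vitushkin_sum C CARD('n) d \<epsilon>)) \<le> 0"
    using assms unfolding metric_span_def SUP_le_iff by simp
  moreover have "\<epsilon> ^ CARD('n) > 0" using assms(2) by simp
  ultimately show ?thesis
    by (metis diff_le_0_iff_le ereal_less_eq(3) mult_le_cancel_left_pos mult_zero_right zero_ereal_def)
qed

theorem proposition3p5: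
  fixes C :: "nat \<Rightarrow> nat \<Rightarrow> real"
    and d :: nat
    and Z :: "(real ^ 'n::finite) set"
  assumes "vitushkin_constants TYPE('n) C"
    and "d \<ge> 1"
    and "Z \<subseteq> unit_cube"
  shows "(entropy_dim Z > ereal (real CARD('n) - 1) \<longrightarrow> metric_span C d Z > 0) \<and>
         (hausdorff_dim Z > ereal (real CARD('n) - 1) \<longrightarrow> metric_span C d Z > 0)"
proof -
  have pos: "C i d > 0" if "i < CARD('n)" for i
    using assms(1,2) that by (simp add: vitushkin_constants_def)
  have entropy: "metric_span C d Z > 0" if dim: "entropy_dim Z > ereal (real CARD('n) - 1)"
  proof (rule ccontr)
    assume "\<not> metric_span C d Z > 0"
    then have span: "metric_span C d Z \<le> 0" by simp
    have "real (covering_number \<epsilon> Z) \<le> (\<Sum>i<CARD('n). C i d) * \<epsilon> powr (-(real CARD('n) - 1))"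
      if "0 < \<epsilon>" "\<epsilon> \<le> 1" for \<epsilon>
      using covering_number_le_if_metric_span_le_0[OF span that(1)]
        vitushkin_sum_le[of "CARD('n)" C d \<epsilon>, OF less_imp_le[OF pos] that]
      by linarith
    then have "entropy_dim Z \<le> ereal (real CARD('n) - 1)"
      unfolding entropy_dim_def by (intro Inf_lower) blast
    then show False using dim by simp
  qed
  moreover have "metric_span C d Z > 0" if dim: "hausdorff_dim Z > ereal (real CARD('n) - 1)"
  proof (rule entropy)
    have "bounded Z" using assms(3) bounded_cbox bounded_subset by blast
    then have "ereal (real CARD('n) - 1) < max 0 (entropy_dim Z)"
      using hausdorff_dim_le_entropy_dim dim by (metis order_less_le_trans)
    moreover have "CARD('n) \<ge> 1" by (simp add: Suc_leI)
    then have "\<not> ereal (real CARD('n) - 1) < 0" by simp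
    ultimately show "entropy_dim Z > ereal (real CARD('n) - 1)"
      by (simp add: less_max_iff_disj)
  qed
  ultimately show ?thesis by blast
qed

end
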